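(* Consider an ensemble of $T$ decision trees over a one-dimensional feature ($d=1$), so that every split of every tree is on the same single feature. Let $\theta_1<\dots<\theta_K$ be the distinct thresholds occurring in the ensemble, and let $\bm{x}\in\mathbb{R}^{K}$ be the vector of split variables shared by all trees. For tree $t\in[T]$ with $p_t$ leaves and leaf scores $s^{(t)}_1,\dots,s^{(t)}_{p_t}\in\mathbb{R}$, let $Q^{expset}_t$ be the set of $(\bm{x},y_t,\bm{z}^{(t)})\in\mathbb{R}^K\times\mathbb{R}\times\mathbb{R}^{p_t}$ satisfying $$\sum_{l\in \mathrm{below}(s)} z^{(t)}_l\le x_{C(s)},\qquad \sum_{l\in \mathrm{above}(s)} z^{(t)}_l\le 1-x_{C(s)}\qquad\forall s\in \mathrm{splits}(t),$$ $$x_j\le x_{j+1}\ \ \forall j\in[K-1],\qquad \sum_{l=1}^{p_t}z^{(t)}_l=1,\qquad y_t=\sum_{l=1}^{p_t}s^{(t)}_lz^{(t)}_l,\qquad \bm{x}\in[0,1]^K,\quad \bm{z}^{(t)}\ge 0 .$$ Then the polyhedron $\bigcap_{t=1}^T Q^{expset}_t$, meaning the set of all $(\bm{x},(y_t)_{t\in[T]},(\bm{z}^{(t)})_{t\in[T]})$ with $(\bm{x},y_t,\bm{z}^{(t)})\in Q^{expset}_t$ for every $t\in[T]$, is ideal: at each of its extreme points, $\bm{x}\in\{0,1\}^K$.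
   Context: Notation: $[n]=\{1,\dots,n\}$. A decision tree is a binary tree. Each internal node is a split $s$, given by a condition $w\le\theta$ on the feature $w$; the left branch corresponds to $w\le\theta$ and the right branch to $w\ge\theta$. Each leaf corresponds to the interval of feature values determined by the splits on the path leading to it. $\mathrm{splits}(t)$ is the set of splits of tree $t$. $\mathrm{left}(s)$ and $\mathrm{right}(s)$ are the sets of leaves (of the tree containing $s$) lying in the left, respectively right, subtree of $s$. $C(s)$ is the rank of the threshold of $s$, i.e. $C(s)=j$ if the threshold of $s$ is $\theta_j$. For a split $s$ of tree $t$, $\mathrm{below}(s)$ is the union of $\mathrm{left}(s')$ over all splits $s'$ of the same tree $t$ with $C(s')\le C(s)$, and $\mathrm{above}(s)$ is the union of $\mathrm{right}(s')$ over all splits $s'$ of the same tree $t$ with $C(s')\ge C(s)$. Interpretation: $x_j=1$ means $w\le\theta_j$, $x_j=0$ means $w\ge\theta_j$; $z^{(t)}_l$ indicates that the feature lies in leaf $l$ of tree $t$. In the mixed-integer formulation only $\bm{x}$ is required to be binary. A formulation with linear relaxation $Q$ is ideal if, at every extreme point of $Q$, all variables required to be binary take values in $\{0,1\}$. *)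

theory Defs
  imports "HOL-Analysis.Analysis" "HOL-Analysis.Finite_Function_Topology"
begin

text \<open>
  Decision trees over one real feature \<open>w\<close>.  \<open>Split c L R\<close> has the condition \<open>w \<le> c\<close>, with
  left branch \<open>L\<close> and right branch \<open>R\<close>.  A leaf carries its index.
\<close>

datatype dtree =
    Leaf nat
  | Split (threshold: real) (left_branch: dtree) (right_branch: dtree)

primrec leaf_list :: "dtree \<Rightarrow> nat list" where
  "leaf_list (Leaf l) = [l]"
| "leaf_list (Split c L R) = leaf_list L @ leaf_list R"

definition leaves_numbered :: "dtree \<Rightarrow> nat \<Rightarrow> bool" where
  "leaves_numbered t p \<longleftrightarrow> distinct (leaf_list t) \<and> set (leaf_list t) = {1..p}"

text \<open>
  A split is represented by the subtree rooted at it.  When the leaf indices of \<open>t\<close> are distinct,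
  different internal nodes root different subtrees, so no two splits are identified, even if they
  have equal thresholds.
\<close>

primrec splits :: "dtree \<Rightarrow> dtree set" where
  "splits (Leaf l) = {}"
| "splits (Split c L R) = insert (Split c L R) (splits L \<union> splits R)"

definition left_leaves :: "dtree \<Rightarrow> nat set" where
  "left_leaves s = set (leaf_list (left_branch s))"

definition right_leaves :: "dtree \<Rightarrow> nat set" where
  "right_leaves s = set (leaf_list (right_branch s))"

text \<open>
  Below, \<open>\<theta> 1 < \<dots> < \<theta> K\<close> are the distinct thresholds of the whole ensemble, so the rank of a
  split of any of its trees is well defined.
\<close>

definition rank :: "nat \<Rightarrow> (nat \<Rightarrow> real) \<Rightarrow> dtree \<Rightarrow> nat" where
  "rank K \<theta> s = (THE j. j \<in> {1..K} \<and> \<theta> j = threshold s)"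

definition below :: "nat \<Rightarrow> (nat \<Rightarrow> real) \<Rightarrow> dtree \<Rightarrow> dtree \<Rightarrow> nat set" where
  "below K \<theta> t s = (\<Union>s' \<in> {s' \<in> splits t. rank K \<theta> s' \<le> rank K \<theta> s}. left_leaves s')"

definition above :: "nat \<Rightarrow> (nat \<Rightarrow> real) \<Rightarrow> dtree \<Rightarrow> dtree \<Rightarrow> nat set" where
  "above K \<theta> t s = (\<Union>s' \<in> {s' \<in> splits t. rank K \<theta> s' \<ge> rank K \<theta> s}. right_leaves s')"

text \<open>
  Vectors with entries indexed by \<open>{1..n}\<close>, for a variable \<open>n\<close>, are finitely supported functions
  whose support lies in \<open>{1..n}\<close>.  The entries outside \<open>{1..n}\<close> have to be pinned to zero: a set
  in which they were free would contain lines and have no extreme points.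
\<close>

definition vecs :: "nat \<Rightarrow> (nat \<Rightarrow>\<^sub>0 'a::zero) set" where
  "vecs n = {v. Poly_Mapping.keys v \<subseteq> {1..n}}"

definition Q_expset ::
  "nat \<Rightarrow> (nat \<Rightarrow> real) \<Rightarrow> dtree \<Rightarrow> nat \<Rightarrow> (nat \<Rightarrow> real) \<Rightarrow>
    ((nat \<Rightarrow>\<^sub>0 real) \<times> real \<times> (nat \<Rightarrow>\<^sub>0 real)) set" where
  "Q_expset K \<theta> t p score = {(x, y, z).
     x \<in> vecs K \<and> z \<in> vecs p \<and>
     (\<forall>s \<in> splits t.
        (\<Sum>l \<in> below K \<theta> t s. Poly_Mapping.lookup z l) \<le> Poly_Mapping.lookup x (rank K \<theta> s) \<and>
        (\<Sum>l \<in> above K \<theta> t s. Poly_Mapping.lookup z l) \<le> 1 - Poly_Mapping.lookup x (rank K \<theta> s)) \<and>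
     (\<forall>j \<in> {1..<K}. Poly_Mapping.lookup x j \<le> Poly_Mapping.lookup x (j + 1)) \<and>
     (\<Sum>l = 1..p. Poly_Mapping.lookup z l) = 1 \<and>
     y = (\<Sum>l = 1..p. score l * Poly_Mapping.lookup z l) \<and>
     (\<forall>j \<in> {1..K}. Poly_Mapping.lookup x j \<in> {0..1}) \<and>
     (\<forall>l \<in> {1..p}. Poly_Mapping.lookup z l \<ge> 0)}"

text \<open>The intersection over all trees, in the space of all variables; only \<open>x\<close> is shared.\<close>

definition Q_ensemble ::
  "nat \<Rightarrow> (nat \<Rightarrow> real) \<Rightarrow> nat \<Rightarrow> (nat \<Rightarrow> dtree) \<Rightarrow> (nat \<Rightarrow> nat) \<Rightarrow> (nat \<Rightarrow> nat \<Rightarrow> real) \<Rightarrow>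
    ((nat \<Rightarrow>\<^sub>0 real) \<times> (nat \<Rightarrow>\<^sub>0 real) \<times> (nat \<Rightarrow>\<^sub>0 nat \<Rightarrow>\<^sub>0 real)) set" where
  "Q_ensemble K \<theta> T tree p score = {(x, y, z).
     x \<in> vecs K \<and> y \<in> vecs T \<and> z \<in> vecs T \<and>
     (\<forall>t \<in> {1..T}. (x, Poly_Mapping.lookup y t, Poly_Mapping.lookup z t)
        \<in> Q_expset K \<theta> (tree t) (p t) (score t))}"

text \<open>\<open>B\<close> is the set of coordinates required to be binary.\<close>

definition ideal_formulation :: "('v::real_vector) set \<Rightarrow> ('v \<Rightarrow> real) set \<Rightarrow> bool" where
  "ideal_formulation Q B \<longleftrightarrow> (\<forall>v. v extreme_point_of Q \<longrightarrow> (\<forall>b \<in> B. b v \<in> {0, 1}))"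

end

theory Submission
  imports Defs
begin

text \<open>
  Fix \<open>x\<close> with \<open>0 \<le> x\<^sub>1 \<le> \<dots> \<le> x\<^sub>K \<le> 1\<close> and replace every threshold \<open>\<theta>\<^sub>j\<close> of a tree by the number \<open>x\<^sub>j\<close>.
  The tree then routes each point of the interval \<open>(0, 1]\<close> to a leaf and so cuts this interval into
  cells, one for each leaf, some of them possibly empty.  The key fact (\<open>Q_expset_iff\<close>) is that
  the constraints of the formulation leave no freedom for \<open>z\<close>: they hold exactly when \<open>z\<^sub>l\<close> is the
  length of the cell of leaf \<open>l\<close>.  Intuitively, \<open>z\<close> is the law of the leaf that a uniformly random
  point of \<open>(0, 1]\<close> reaches.

  One half, that cell lengths are feasible, holds because the cells of the leaves in \<open>below(s)\<close> are
  disjoint and lie in \<open>(0, x\<^sub>C\<^sub>(\<^sub>s\<^sub>)]\<close>, and dually for \<open>above(s)\<close>.  The other half, uniqueness, is an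
  induction down the tree (\<open>cell_length_unique\<close>): the two inequalities at a split bound the masses
  of its two subtrees by the lengths of the two parts into which the current interval is cut, and
  these lengths add up to the mass available, so both bounds are attained.

  Hence the polyhedron is parametrised by the monotone vectors \<open>x \<in> [0, 1]\<^sup>K\<close> alone, whatever the number
  of trees.  It remains to split a fractional \<open>x\<close>.  Take \<open>F v = min 1 (2 v)\<close> and
  \<open>G v = max 0 (2 v - 1)\<close>, which have mean \<open>v\<close>.  Both are monotone and fix \<open>0\<close> and \<open>1\<close>,
  and so map monotone vectors in the box to such vectors.  Cell lengths are differences of interval end points, and these end points are
  obtained from \<open>0\<close>, \<open>1\<close> and the entries of \<open>x\<close> by minima and maxima, which commute with monotone maps.  So the
  point over \<open>x\<close> is the midpoint of the points over \<open>F \<circ> x\<close> and \<open>G \<circ> x\<close>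
  (\<open>ensemble_point_average\<close>).  As \<open>F v \<noteq> G v\<close> for \<open>0 < v < 1\<close>, a point with a fractional entry
  of \<open>x\<close> is not extreme.

  A leaf whose path conditions contradict each other receives an empty cell in this picture, and the
  uniqueness part shows that the constraints do force its variable to \<open>0\<close>.
\<close>

section \<open>Cells cut out by a tree\<close>

text \<open>
  The length of the set of points of \<open>(a, b]\<close> that reach leaf \<open>l\<close> when a split with threshold \<open>c\<close>
  sends a point \<open>u\<close> to the left iff \<open>u \<le> g c\<close>.  The end points may cross on the way down (\<open>b < a\<close>);
  the interval is then empty, and stays so.
\<close>

fun cell_length :: "dtree \<Rightarrow> (real \<Rightarrow> real) \<Rightarrow> real \<Rightarrow> real \<Rightarrow> nat \<Rightarrow> real" where
  "cell_length (Leaf k) g a b l = (if l = k then max 0 (b - a) else 0)"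
| "cell_length (Split c L R) g a b l =
     cell_length L g a (min b (g c)) l + cell_length R g (max a (g c)) b l"

lemma cell_length_nonneg: "0 \<le> cell_length t g a b l"
  by (induction t arbitrary: a b) auto

lemma cell_length_outside: "l \<notin> set (leaf_list t) \<Longrightarrow> cell_length t g a b l = 0"
  by (induction t arbitrary: a b) auto

lemma sum_cell_length_Split:
  assumes "distinct (leaf_list (Split c L R))" "A \<subseteq> set (leaf_list L)" "B \<subseteq> set (leaf_list R)"
  shows "(\<Sum>l \<in> A \<union> B. cell_length (Split c L R) g a b l) =
    (\<Sum>l \<in> A. cell_length L g a (min b (g c)) l) + (\<Sum>l \<in> B. cell_length R g (max a (g c)) b l)"
proof -
  have fin: "finite A" "finite B"
    using assms(2,3) by (auto intro: finite_subset)
  have "(\<Sum>l \<in> A. cell_length (Split c L R) g a b l) = (\<Sum>l \<in> A. cell_length L g a (min b (g c)) l)"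
    using assms by (intro sum.cong) (auto intro!: cell_length_outside)
  moreover have "(\<Sum>l \<in> B. cell_length (Split c L R) g a b l) = (\<Sum>l \<in> B. cell_length R g (max a (g c)) b l)"
    using assms by (intro sum.cong) (auto intro!: cell_length_outside)
  moreover have "A \<inter> B = {}"
    using assms by auto
  ultimately show ?thesis
    using fin by (simp add: sum.union_disjoint del: cell_length.simps)
qed

lemma sum_cell_length:
  "distinct (leaf_list t) \<Longrightarrow> (\<Sum>l \<in> set (leaf_list t). cell_length t g a b l) = max 0 (b - a)"
proof (induction t arbitrary: a b)
  case (Split c L R)
  show ?case
    using Split sum_cell_length_Split[of c L R "set (leaf_list L)" "set (leaf_list R)" g a b]
    by (auto simp del: cell_length.simps)
qed simp

lemma left_leaves_subset: "s \<in> splits t \<Longrightarrow> left_leaves s \<subseteq> set (leaf_list t)"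
  by (induction t) (auto simp: left_leaves_def)

lemma right_leaves_subset: "s \<in> splits t \<Longrightarrow> right_leaves s \<subseteq> set (leaf_list t)"
  by (induction t) (auto simp: right_leaves_def)

text \<open>
  A leaf below a left branch of some split with value at most \<open>v\<close> has its cell inside \<open>(a, b]\<close> and
  inside \<open>(-\<infinity>, v]\<close>, and different leaves have disjoint cells.
\<close>

lemma sum_cell_length_below:
  "distinct (leaf_list t) \<Longrightarrow>
    (\<Sum>l \<in> (\<Union>s \<in> {s \<in> splits t. g (threshold s) \<le> v}. left_leaves s). cell_length t g a b l)
      \<le> max 0 (min b v - a)"
proof (induction t arbitrary: a b)
  case (Split c L R)
  define D where "D t = (\<Union>s \<in> {s \<in> splits t. g (threshold s) \<le> v}. left_leaves s)" for t
  have sub: "D t \<subseteq> set (leaf_list t)" for t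
    using left_leaves_subset by (auto simp: D_def)
  have IH: "sum (cell_length L g a (min b (g c))) (D L) \<le> max 0 (min (min b (g c)) v - a)"
    "sum (cell_length R g (max a (g c)) b) (D R) \<le> max 0 (min b v - max a (g c))"
    unfolding D_def using Split.prems by (intro Split.IH; simp)+
  have D_Split: "D (Split c L R) = (if g c \<le> v then set (leaf_list L) else D L) \<union> D R"
    using sub[of L] by (auto simp: D_def left_leaves_def)
  have "sum (cell_length (Split c L R) g a b) (D (Split c L R)) \<le> max 0 (min b v - a)"
  proof (cases "g c \<le> v")
    case True
    have "sum (cell_length (Split c L R) g a b) (D (Split c L R)) =
      max 0 (min b (g c) - a) + sum (cell_length R g (max a (g c)) b) (D R)"
      using True Split.prems sum_cell_length_Split[OF Split.prems subset_refl sub]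
      by (simp add: D_Split sum_cell_length del: cell_length.simps)
    with IH(2) True show ?thesis by linarith
  next
    case False
    have "sum (cell_length (Split c L R) g a b) (D (Split c L R)) =
      sum (cell_length L g a (min b (g c))) (D L) + sum (cell_length R g (max a (g c)) b) (D R)"
      using False sum_cell_length_Split[OF Split.prems sub sub]
      by (simp add: D_Split del: cell_length.simps)
    with IH False show ?thesis by linarith
  qed
  then show ?case by (simp add: D_def del: cell_length.simps splits.simps)
qed simp

text \<open>The mirror image: such cells lie inside \<open>(v, \<infinity>)\<close>.\<close>

lemma sum_cell_length_above:
  "distinct (leaf_list t) \<Longrightarrow>
    (\<Sum>l \<in> (\<Union>s \<in> {s \<in> splits t. v \<le> g (threshold s)}. right_leaves s). cell_length t g a b l)
      \<le> max 0 (b - max a v)"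
proof (induction t arbitrary: a b)
  case (Split c L R)
  define D where "D t = (\<Union>s \<in> {s \<in> splits t. v \<le> g (threshold s)}. right_leaves s)" for t
  have sub: "D t \<subseteq> set (leaf_list t)" for t
    using right_leaves_subset by (auto simp: D_def)
  have IH: "sum (cell_length L g a (min b (g c))) (D L) \<le> max 0 (min b (g c) - max a v)"
    "sum (cell_length R g (max a (g c)) b) (D R) \<le> max 0 (b - max (max a (g c)) v)"
    unfolding D_def using Split.prems by (intro Split.IH; simp)+
  have D_Split: "D (Split c L R) = D L \<union> (if v \<le> g c then set (leaf_list R) else D R)"
    using sub[of R] by (auto simp: D_def right_leaves_def)
  have "sum (cell_length (Split c L R) g a b) (D (Split c L R)) \<le> max 0 (b - max a v)"
  proof (cases "v \<le> g c")
    case True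
    have "sum (cell_length (Split c L R) g a b) (D (Split c L R)) =
      sum (cell_length L g a (min b (g c))) (D L) + max 0 (b - max a (g c))"
      using True Split.prems sum_cell_length_Split[OF Split.prems sub subset_refl]
      by (simp add: D_Split sum_cell_length del: cell_length.simps)
    with IH(1) True show ?thesis by linarith
  next
    case False
    have "sum (cell_length (Split c L R) g a b) (D (Split c L R)) =
      sum (cell_length L g a (min b (g c))) (D L) + sum (cell_length R g (max a (g c)) b) (D R)"
      using False sum_cell_length_Split[OF Split.prems sub sub]
      by (simp add: D_Split del: cell_length.simps)
    with IH False show ?thesis by linarith
  qed
  then show ?case by (simp add: D_def del: cell_length.simps splits.simps)
qed simp

section \<open>Feasible leaf masses are cell lengths\<close>

text \<open>
  This passes a capacity constraint from a node to one of its children.  The leaf sets \<open>P\<close> and \<open>S\<close>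
  are \<open>below\<close> of two splits with values \<open>p\<close> and \<open>q\<close>, so they are nested in the order of \<open>p\<close> and \<open>q\<close>.
  The child with leaves \<open>M\<close> lies wholly in \<open>P\<close> and exhausts the room between \<open>a\<close> and \<open>p\<close>.  The
  other child, with leaves \<open>N\<close>, then has only the room between \<open>p\<close> and \<open>q\<close> left for its leaves in
  \<open>S\<close>.  For \<open>above\<close> the lemma applies with all values negated.
\<close>

lemma sum_remaining_le:
  fixes z :: "nat \<Rightarrow> real"
  assumes fin: "finite M" "finite N" and disj: "M \<inter> N = {}"
    and nonneg: "\<And>l. l \<in> M \<union> N \<Longrightarrow> 0 \<le> z l"
    and "M \<subseteq> P"
    and nested: "S \<subseteq> P \<and> q \<le> p \<or> P \<subseteq> S \<and> p \<le> q"
    and P: "sum z ((M \<union> N) \<inter> P) \<le> max 0 (p - a)"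
    and S: "sum z ((M \<union> N) \<inter> S) \<le> max 0 (q - a)"
    and M: "sum z M = max 0 (p - a)"
  shows "sum z (N \<inter> S) \<le> max 0 (q - max a p)"
  using nested
proof
  assume le: "S \<subseteq> P \<and> q \<le> p"
  have "(M \<union> N) \<inter> P = M \<union> N \<inter> P" using \<open>M \<subseteq> P\<close> by auto
  then have "sum z ((M \<union> N) \<inter> P) = sum z M + sum z (N \<inter> P)"
    using fin disj by (metis finite_Int inf_assoc inf_bot_left sum.union_disjoint)
  moreover have "sum z (N \<inter> S) \<le> sum z (N \<inter> P)"
    using le fin nonneg by (intro sum_mono2) auto
  ultimately show ?thesis using P M by linarith
next
  assume ge: "P \<subseteq> S \<and> p \<le> q"
  then have "(M \<union> N) \<inter> S = M \<union> N \<inter> S" using \<open>M \<subseteq> P\<close> by auto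
  then have "sum z ((M \<union> N) \<inter> S) = sum z M + sum z (N \<inter> S)"
    using fin disj by (metis finite_Int inf_assoc inf_bot_left sum.union_disjoint)
  then show ?thesis using S M ge by linarith
qed

text \<open>
  The induction carries three facts about the subtree reached with interval \<open>(a, b]\<close>: its mass is
  the length of \<open>(a, b]\<close>, its leaves in \<open>B s\<close> carry at most the mass of \<open>(a, g s]\<close>, and its leaves in
  \<open>A s\<close> at most that of \<open>(g s, b]\<close>.  The constraints refer to whole trees, but in this form only the
  splits inside the subtree matter, and the leaves outside it are recorded by \<open>a\<close> and \<open>b\<close> alone.
  Splits are compared by \<open>r\<close> and not by the values \<open>g\<close>, since different thresholds may receive
  equal values while their sets \<open>B\<close> and \<open>A\<close> differ.
\<close>

lemma cell_length_unique:
  fixes r :: "dtree \<Rightarrow> nat" and z :: "nat \<Rightarrow> real"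
  assumes B_mono: "\<And>s s'. r s \<le> r s' \<Longrightarrow> B s \<subseteq> B s'"
    and A_antimono: "\<And>s s'. r s \<le> r s' \<Longrightarrow> A s' \<subseteq> A s"
  shows "\<lbrakk>distinct (leaf_list t);
      \<And>l. l \<in> set (leaf_list t) \<Longrightarrow> 0 \<le> z l;
      \<And>s. s \<in> splits t \<Longrightarrow> left_leaves s \<subseteq> B s;
      \<And>s. s \<in> splits t \<Longrightarrow> right_leaves s \<subseteq> A s;
      \<And>s s'. \<lbrakk>s \<in> splits t; s' \<in> splits t; r s \<le> r s'\<rbrakk> \<Longrightarrow> g (threshold s) \<le> g (threshold s');
      sum z (set (leaf_list t)) = max 0 (b - a);
      \<And>s. s \<in> splits t \<Longrightarrow> sum z (set (leaf_list t) \<inter> B s) \<le> max 0 (g (threshold s) - a);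
      \<And>s. s \<in> splits t \<Longrightarrow> sum z (set (leaf_list t) \<inter> A s) \<le> max 0 (b - g (threshold s));
      l \<in> set (leaf_list t)\<rbrakk>
    \<Longrightarrow> z l = cell_length t g a b l"
proof (induction t arbitrary: a b)
  case (Leaf k)
  then show ?case by simp
next
  case (Split c L R)
  let ?s = "Split c L R"
  let ?M = "set (leaf_list L)" and ?N = "set (leaf_list R)"
  note nonneg = Split.prems(2) and left = Split.prems(3) and right = Split.prems(4)
    and g_mono = Split.prems(5) and total = Split.prems(6) and low = Split.prems(7)
    and high = Split.prems(8)
  have disj: "?M \<inter> ?N = {}" using Split.prems(1) by auto
  have MN: "set (leaf_list ?s) = ?M \<union> ?N" by simp
  have M_B: "?M \<subseteq> B ?s" using left[of ?s] by (simp add: left_leaves_def)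
  have N_A: "?N \<subseteq> A ?s" using right[of ?s] by (simp add: right_leaves_def)
  have total': "sum z ?M + sum z ?N = max 0 (b - a)"
    using total disj by (simp add: sum.union_disjoint)
  have M_nonneg: "0 \<le> sum z ?M" and N_nonneg: "0 \<le> sum z ?N"
    using nonneg by (auto intro!: sum_nonneg)
  have M_le: "sum z ?M \<le> max 0 (g c - a)"
  proof -
    have "sum z ?M \<le> sum z ((?M \<union> ?N) \<inter> B ?s)"
      using M_B nonneg by (intro sum_mono2) auto
    also have "\<dots> \<le> max 0 (g c - a)" using low[of ?s] by simp
    finally show ?thesis .
  qed
  have N_le: "sum z ?N \<le> max 0 (b - g c)"
  proof -
    have "sum z ?N \<le> sum z ((?M \<union> ?N) \<inter> A ?s)"
      using N_A nonneg by (intro sum_mono2) auto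
    also have "\<dots> \<le> max 0 (b - g c)" using high[of ?s] by simp
    finally show ?thesis .
  qed
  \<comment> \<open>The upper bounds \<open>M_le\<close> and \<open>N_le\<close> leave no slack: clipped to \<open>(a, b]\<close> they sum to the total mass.\<close>
  have M: "sum z ?M = max 0 (min b (g c) - a)" and N: "sum z ?N = max 0 (b - max a (g c))"
    using total' M_nonneg N_nonneg M_le N_le by linarith+
  have zL: "z l = cell_length L g a (min b (g c)) l" if "l \<in> ?M"
  proof (rule Split.IH(1))
    fix s assume s: "s \<in> splits L"
    have "sum z (?M \<inter> B s) \<le> sum z ((?M \<union> ?N) \<inter> B s)"
      using nonneg by (intro sum_mono2) auto
    then show "sum z (?M \<inter> B s) \<le> max 0 (g (threshold s) - a)"
      using low[of s] s by simp
    show "sum z (?M \<inter> A s) \<le> max 0 (min b (g c) - g (threshold s))"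
    \<comment> \<open>In the first case the right child has the full mass of \<open>(g c, b]\<close>, as \<open>sum_remaining_le\<close>
      requires; in the second the left child has no mass at all.\<close>
    proof (cases "a < b \<and> a \<le> g c")
      case True
      have nest: "A s \<subseteq> A ?s \<and> - g (threshold s) \<le> - g c \<or> A ?s \<subseteq> A s \<and> - g c \<le> - g (threshold s)"
        using A_antimono[of s ?s] A_antimono[of ?s s] g_mono[of s ?s] g_mono[of ?s s] s
        by (cases "r s \<le> r ?s") auto
      have "sum z (?M \<inter> A s) \<le> max 0 (- g (threshold s) - max (- b) (- g c))"
        using disj nonneg N_A high[of ?s] high[of s] s True N
        by (intro sum_remaining_le[OF _ _ _ _ N_A nest]) (auto simp: Un_commute)
      then show ?thesis by linarith
    next
      case False
      have "sum z (?M \<inter> A s) \<le> sum z ?M"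
        using nonneg by (intro sum_mono2) auto
      with False M show ?thesis by linarith
    qed
  qed (use Split.prems that M in auto)
  have zR: "z l = cell_length R g (max a (g c)) b l" if "l \<in> ?N"
  proof (rule Split.IH(2))
    fix s assume s: "s \<in> splits R"
    have "sum z (?N \<inter> A s) \<le> sum z ((?M \<union> ?N) \<inter> A s)"
      using nonneg by (intro sum_mono2) auto
    then show "sum z (?N \<inter> A s) \<le> max 0 (b - g (threshold s))"
      using high[of s] s by simp
    show "sum z (?N \<inter> B s) \<le> max 0 (g (threshold s) - max a (g c))"
    proof (cases "a < b \<and> g c \<le> b")
      case True
      have nest: "B s \<subseteq> B ?s \<and> g (threshold s) \<le> g c \<or> B ?s \<subseteq> B s \<and> g c \<le> g (threshold s)"
        using B_mono[of s ?s] B_mono[of ?s s] g_mono[of s ?s] g_mono[of ?s s] s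
        by (cases "r s \<le> r ?s") auto
      show ?thesis
        using disj nonneg M_B low[of ?s] low[of s] s True M
        by (intro sum_remaining_le[OF _ _ _ _ M_B nest]) auto
    next
      case False
      have "sum z (?N \<inter> B s) \<le> sum z ?N"
        using nonneg by (intro sum_mono2) auto
      with False N show ?thesis by linarith
    qed
  qed (use Split.prems that N in auto)
  consider "l \<in> ?M" "l \<notin> ?N" | "l \<in> ?N" "l \<notin> ?M"
    using Split.prems(9) disj by auto
  then show ?case
    by cases (simp_all add: zL zR cell_length_outside)
qed

section \<open>Cell lengths under monotone changes of the thresholds\<close>

text \<open>
  A monotone map does not change the routing pattern: minima and maxima are taken at the same places,
  so an interval \<open>(a, b]\<close> arriving at a leaf becomes \<open>(F a, F b]\<close>, and emptiness is preserved.
\<close>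

lemma cell_length_average:
  assumes F: "mono F" and G: "mono G" and FG: "\<And>v. F v + G v = 2 * v"
  shows "cell_length t (F \<circ> g) (F a) (F b) l + cell_length t (G \<circ> g) (G a) (G b) l =
    2 * cell_length t g a b l"
proof (induction t arbitrary: a b)
  case (Leaf k)
  show ?case
    using FG[of a] FG[of b] monoD[OF F, of a b] monoD[OF F, of b a] monoD[OF G, of a b]
      monoD[OF G, of b a] by (cases "a \<le> b") auto
next
  case (Split c L R)
  show ?case
    using Split[of a "min b (g c)"] Split[of "max a (g c)" b]
    by (simp add: min_of_mono[OF F] min_of_mono[OF G] max_of_mono[OF F] max_of_mono[OF G])
qed


section \<open>The formulation of one tree as a graph over the split variables\<close>

lemma lookup_scaleR: "Poly_Mapping.lookup (r *\<^sub>R f) i = r *\<^sub>R Poly_Mapping.lookup f i"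
proof -
  have "finite {i. r *\<^sub>R Poly_Mapping.lookup f i \<noteq> 0}"
    by (rule finite_subset[OF _ finite_lookup[of f]]) auto
  then show ?thesis by (simp add: scaleR_poly_mapping_def)
qed

lemma lookup_map_zero: "f 0 = 0 \<Longrightarrow> Poly_Mapping.lookup (Poly_Mapping.map f v) i = f (Poly_Mapping.lookup v i)"
  by (simp add: map.rep_eq when_def)

definition cell_vector :: "dtree \<Rightarrow> (real \<Rightarrow> real) \<Rightarrow> nat \<Rightarrow>\<^sub>0 real" where
  "cell_vector t g = Abs_poly_mapping (cell_length t g 0 1)"

lemma lookup_cell_vector [simp]: "Poly_Mapping.lookup (cell_vector t g) = cell_length t g 0 1"
  unfolding cell_vector_def
  by (rule lookup_Abs_poly_mapping, rule finite_subset[of _ "set (leaf_list t)"])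
    (auto intro: ccontr simp: cell_length_outside)

text \<open>The value that \<open>x\<close> gives to a threshold \<open>c\<close>: the entry of \<open>x\<close> at the rank of \<open>c\<close>.\<close>

definition threshold_value :: "nat \<Rightarrow> (nat \<Rightarrow> real) \<Rightarrow> (nat \<Rightarrow>\<^sub>0 real) \<Rightarrow> real \<Rightarrow> real" where
  "threshold_value K \<theta> x c = Poly_Mapping.lookup x (THE j. j \<in> {1..K} \<and> \<theta> j = c)"

lemma lookup_rank: "Poly_Mapping.lookup x (rank K \<theta> s) = threshold_value K \<theta> x (threshold s)"
  unfolding threshold_value_def rank_def by (rule refl)

lemma rank_correct:
  assumes "strict_mono_on {1..K} \<theta>" and "threshold s \<in> \<theta> ` {1..K}"
  shows "rank K \<theta> s \<in> {1..K} \<and> \<theta> (rank K \<theta> s) = threshold s"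
proof -
  obtain i where i: "i \<in> {1..K}" "\<theta> i = threshold s"
    using assms(2) by fastforce
  have unique: "j = i" if "j \<in> {1..K} \<and> \<theta> j = threshold s" for j
    using inj_on_eq_iff[OF strict_mono_on_imp_inj_on[OF assms(1)], of j i] i that by metis
  have "rank K \<theta> s = i"
    unfolding rank_def by (rule the_equality) (rule conjI[OF i], rule unique)
  with i show ?thesis by simp
qed

definition monotone_box :: "nat \<Rightarrow> (nat \<Rightarrow>\<^sub>0 real) set" where
  "monotone_box K = {x \<in> vecs K.
     (\<forall>j \<in> {1..<K}. Poly_Mapping.lookup x j \<le> Poly_Mapping.lookup x (j + 1)) \<and>
     (\<forall>j \<in> {1..K}. Poly_Mapping.lookup x j \<in> {0..1})}"

lemma monotone_box_mono:
  assumes x: "x \<in> monotone_box K" and "i \<in> {1..K}" "j \<in> {1..K}" "i \<le> j"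
  shows "Poly_Mapping.lookup x i \<le> Poly_Mapping.lookup x j"
  using \<open>i \<le> j\<close> \<open>j \<in> {1..K}\<close>
proof (induction j rule: dec_induct)
  case (step n)
  then have "Poly_Mapping.lookup x n \<le> Poly_Mapping.lookup x (n + 1)"
    using x \<open>i \<in> {1..K}\<close> by (auto simp: monotone_box_def)
  with step show ?case using \<open>i \<in> {1..K}\<close> by auto
qed simp

lemma monotone_box_map:
  assumes x: "x \<in> monotone_box K" and F: "mono F" "F 0 = 0" "F 1 = 1"
  shows "Poly_Mapping.map F x \<in> monotone_box K"
proof -
  have "0 \<le> F v \<and> F v \<le> 1" if "0 \<le> v" "v \<le> 1" for v
    using monoD[OF F(1) that(1)] monoD[OF F(1) that(2)] F by simp
  moreover have "Poly_Mapping.keys (Poly_Mapping.map F x) \<subseteq> Poly_Mapping.keys x"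
    using F(2) by (auto simp: in_keys_iff lookup_map_zero)
  then have "Poly_Mapping.map F x \<in> vecs K"
    using x unfolding monotone_box_def vecs_def by blast
  ultimately show ?thesis
    using x monoD[OF F(1)] by (simp add: monotone_box_def lookup_map_zero[of F, OF F(2)])
qed

text \<open>
  For uniqueness, the constraints at the splits are the capacity bounds of \<open>cell_length_unique\<close> for the interval
  \<open>(0, 1]\<close>.  For feasibility, a split of smaller rank never has a larger value because \<open>x\<close> is monotone, so
  \<open>below(s)\<close> and \<open>above(s)\<close> are covered by the leaf sets of \<open>sum_cell_length_below\<close> and
  \<open>sum_cell_length_above\<close>.
\<close>

lemma Q_expset_iff:
  assumes t: "leaves_numbered t p" and \<theta>: "threshold ` splits t \<subseteq> \<theta> ` {1..K}"
    and increasing: "strict_mono_on {1..K} \<theta>"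
  shows "(x, y, z) \<in> Q_expset K \<theta> t p score \<longleftrightarrow>
    x \<in> monotone_box K \<and> z = cell_vector t (threshold_value K \<theta> x) \<and>
    y = (\<Sum>l = 1..p. score l * Poly_Mapping.lookup z l)"
proof -
  define g where "g = threshold_value K \<theta> x"
  let ?z = "Poly_Mapping.lookup z"
  have dist: "distinct (leaf_list t)" and leaves: "set (leaf_list t) = {1..p}"
    using t by (auto simp: leaves_numbered_def)
  have rank: "rank K \<theta> s \<in> {1..K} \<and> \<theta> (rank K \<theta> s) = threshold s" if "s \<in> splits t" for s
    using rank_correct[OF increasing] \<theta> that by blast
  have below_subset: "below K \<theta> t s \<subseteq> set (leaf_list t)" for s
    using left_leaves_subset by (auto simp: below_def)
  have above_subset: "above K \<theta> t s \<subseteq> set (leaf_list t)" for s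
    using right_leaves_subset by (auto simp: above_def)
  have g_mono: "g (threshold s) \<le> g (threshold s')"
    if "x \<in> monotone_box K" "s \<in> splits t" "s' \<in> splits t" "rank K \<theta> s \<le> rank K \<theta> s'" for s s'
    using monotone_box_mono[OF that(1)] rank that by (simp add: g_def flip: lookup_rank)
  have g_bounds: "0 \<le> g (threshold s) \<and> g (threshold s) \<le> 1"
    if "x \<in> monotone_box K" "s \<in> splits t" for s
    using rank[OF that(2)] that(1) by (auto simp: g_def monotone_box_def simp flip: lookup_rank)
  have cells: "z = cell_vector t g"
    if x: "x \<in> monotone_box K" and z: "z \<in> vecs p" and nonneg: "\<forall>l \<in> {1..p}. 0 \<le> ?z l"
      and total: "sum ?z {1..p} = 1"
      and low: "\<forall>s \<in> splits t. sum ?z (below K \<theta> t s) \<le> g (threshold s)"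
      and high: "\<forall>s \<in> splits t. sum ?z (above K \<theta> t s) \<le> 1 - g (threshold s)"
  proof (rule poly_mapping_eqI)
    fix l
    have "?z l = cell_length t g 0 1 l" if "l \<in> set (leaf_list t)"
    proof (rule cell_length_unique[where r = "rank K \<theta>" and B = "below K \<theta> t" and A = "above K \<theta> t"])
      show "sum ?z (set (leaf_list t) \<inter> below K \<theta> t s) \<le> max 0 (g (threshold s) - 0)"
        if "s \<in> splits t" for s
        using low that below_subset[of s] by (simp add: Int_absorb1 le_max_iff_disj)
      show "sum ?z (set (leaf_list t) \<inter> above K \<theta> t s) \<le> max 0 (1 - g (threshold s))"
        if "s \<in> splits t" for s
        using high that above_subset[of s] by (simp add: Int_absorb1 le_max_iff_disj)
      show "sum ?z (set (leaf_list t)) = max 0 (1 - 0)"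
        using total by (simp add: leaves)
    qed (use dist leaves nonneg that g_mono[OF x] in \<open>auto simp: below_def above_def\<close>)
    moreover have "?z l = 0" if "l \<notin> set (leaf_list t)"
      using z that by (auto simp: vecs_def leaves in_keys_iff)
    ultimately show "?z l = Poly_Mapping.lookup (cell_vector t g) l"
      using cell_length_outside by fastforce
  qed
  have cell_vecs: "cell_vector t g \<in> vecs p"
    using leaves cell_length_outside by (fastforce simp: vecs_def in_keys_iff)
  have cell_total: "sum (cell_length t g 0 1) {1..p} = 1"
    using sum_cell_length[OF dist, of g 0 1] by (simp add: leaves)
  have cell_below: "sum (cell_length t g 0 1) (below K \<theta> t s) \<le> g (threshold s)"
    if "x \<in> monotone_box K" "s \<in> splits t" for s
  proof -
    let ?D = "\<Union>s' \<in> {s' \<in> splits t. g (threshold s') \<le> g (threshold s)}. left_leaves s'"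
    have "?D \<subseteq> set (leaf_list t)" using left_leaves_subset by auto
    then have "finite ?D" using finite_subset by blast
    moreover have "below K \<theta> t s \<subseteq> ?D"
      using g_mono that by (fastforce simp: below_def)
    ultimately have "sum (cell_length t g 0 1) (below K \<theta> t s) \<le> sum (cell_length t g 0 1) ?D"
      by (intro sum_mono2) (auto simp: cell_length_nonneg)
    also have "\<dots> \<le> g (threshold s)"
      using sum_cell_length_below[OF dist, where g = g and v = "g (threshold s)" and a = 0 and b = 1] g_bounds[OF that] by simp
    finally show ?thesis .
  qed
  have cell_above: "sum (cell_length t g 0 1) (above K \<theta> t s) \<le> 1 - g (threshold s)"
    if "x \<in> monotone_box K" "s \<in> splits t" for s
  proof -
    let ?D = "\<Union>s' \<in> {s' \<in> splits t. g (threshold s) \<le> g (threshold s')}. right_leaves s'"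
    have "?D \<subseteq> set (leaf_list t)" using right_leaves_subset by auto
    then have "finite ?D" using finite_subset by blast
    moreover have "above K \<theta> t s \<subseteq> ?D"
      using g_mono that by (fastforce simp: above_def)
    ultimately have "sum (cell_length t g 0 1) (above K \<theta> t s) \<le> sum (cell_length t g 0 1) ?D"
      by (intro sum_mono2) (auto simp: cell_length_nonneg)
    also have "\<dots> \<le> 1 - g (threshold s)"
      using sum_cell_length_above[OF dist, where g = g and v = "g (threshold s)" and a = 0 and b = 1] g_bounds[OF that] by simp
    finally show ?thesis .
  qed
  have Q: "(x, y, z) \<in> Q_expset K \<theta> t p score \<longleftrightarrow>
      x \<in> monotone_box K \<and> z \<in> vecs p \<and> (\<forall>l \<in> {1..p}. 0 \<le> ?z l) \<and> sum ?z {1..p} = 1 \<and>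
      (\<forall>s \<in> splits t. sum ?z (below K \<theta> t s) \<le> g (threshold s)) \<and>
      (\<forall>s \<in> splits t. sum ?z (above K \<theta> t s) \<le> 1 - g (threshold s)) \<and>
      y = (\<Sum>l = 1..p. score l * ?z l)"
    unfolding Q_expset_def g_def monotone_box_def lookup_rank mem_Collect_eq prod.case by blast
  show ?thesis
    unfolding Q g_def[symmetric]
  proof (intro iffI)
    assume "x \<in> monotone_box K \<and> z = cell_vector t g \<and> y = (\<Sum>l = 1..p. score l * ?z l)"
    then have "x \<in> monotone_box K" "z = cell_vector t g" "y = (\<Sum>l = 1..p. score l * ?z l)"
      by blast+
    moreover from this have "?z = cell_length t g 0 1"
      by simp
    ultimately show "x \<in> monotone_box K \<and> z \<in> vecs p \<and> (\<forall>l \<in> {1..p}. 0 \<le> ?z l) \<and> sum ?z {1..p} = 1 \<and>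
      (\<forall>s \<in> splits t. sum ?z (below K \<theta> t s) \<le> g (threshold s)) \<and>
      (\<forall>s \<in> splits t. sum ?z (above K \<theta> t s) \<le> 1 - g (threshold s)) \<and>
      y = (\<Sum>l = 1..p. score l * ?z l)"
      using cell_vecs cell_total cell_below cell_above cell_length_nonneg by metis
  qed (use cells in blast)
qed

section \<open>The ensemble\<close>

definition ensemble_point ::
  "nat \<Rightarrow> (nat \<Rightarrow> real) \<Rightarrow> nat \<Rightarrow> (nat \<Rightarrow> dtree) \<Rightarrow> (nat \<Rightarrow> nat) \<Rightarrow> (nat \<Rightarrow> nat \<Rightarrow> real) \<Rightarrow>
    (nat \<Rightarrow>\<^sub>0 real) \<Rightarrow> (nat \<Rightarrow>\<^sub>0 real) \<times> (nat \<Rightarrow>\<^sub>0 real) \<times> (nat \<Rightarrow>\<^sub>0 nat \<Rightarrow>\<^sub>0 real)" where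
  "ensemble_point K \<theta> T tree p score x =
    (let cells = (\<lambda>t. cell_vector (tree t) (threshold_value K \<theta> x)) in
     (x,
      Abs_poly_mapping (\<lambda>t. (\<Sum>l = 1..p t. score t l * Poly_Mapping.lookup (cells t) l) when t \<in> {1..T}),
      Abs_poly_mapping (\<lambda>t. cells t when t \<in> {1..T})))"

lemma lookup_Abs_when [simp]:
  "Poly_Mapping.lookup (Abs_poly_mapping (\<lambda>t. f t when t \<in> {1..T})) = (\<lambda>t. f t when t \<in> {1..T::nat})"
  by (rule lookup_Abs_poly_mapping, rule finite_subset[of _ "{1..T}"]) auto

text \<open>
  Since each tree determines its \<open>y\<^sub>t\<close> and \<open>z\<^sup>(\<^sup>t\<^sup>)\<close> from the shared \<open>x\<close>, intersecting over the trees
  imposes nothing beyond the constraints on \<open>x\<close>.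
\<close>

lemma Q_ensemble_eq_image:
  assumes leaves: "\<And>t. t \<in> {1..T} \<Longrightarrow> leaves_numbered (tree t) (p t)"
    and thresholds: "\<theta> ` {1..K} = (\<Union>t \<in> {1..T}. threshold ` splits (tree t))"
    and increasing: "strict_mono_on {1..K} \<theta>"
  shows "Q_ensemble K \<theta> T tree p score = ensemble_point K \<theta> T tree p score ` monotone_box K"
proof -
  have iff: "(x, y, z) \<in> Q_expset K \<theta> (tree t) (p t) (score t) \<longleftrightarrow>
      x \<in> monotone_box K \<and> z = cell_vector (tree t) (threshold_value K \<theta> x) \<and>
      y = (\<Sum>l = 1..p t. score t l * Poly_Mapping.lookup z l)" if "t \<in> {1..T}" for x y z t
    using Q_expset_iff[OF leaves[OF that] _ increasing] thresholds that by blast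
  have box: "x \<in> monotone_box K" if "(x, y, z) \<in> Q_ensemble K \<theta> T tree p score" for x y z
  \<comment> \<open>Without trees the definition does not constrain \<open>x\<close> to the box, but then there are no
    thresholds either.\<close>
  proof (cases "T = 0")
    case True
    then have "K = 0" using thresholds by auto
    then show ?thesis using that by (auto simp: Q_ensemble_def monotone_box_def)
  next
    case False
    then have "(x, Poly_Mapping.lookup y 1, Poly_Mapping.lookup z 1)
        \<in> Q_expset K \<theta> (tree 1) (p 1) (score 1)"
      using that by (auto simp: Q_ensemble_def)
    then show ?thesis using iff[of 1] False by auto
  qed
  have "(x, y, z) \<in> Q_ensemble K \<theta> T tree p score \<longleftrightarrow>
      x \<in> monotone_box K \<and> (x, y, z) = ensemble_point K \<theta> T tree p score x" for x y z
  proof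
    assume Q: "(x, y, z) \<in> Q_ensemble K \<theta> T tree p score"
    have outside: "Poly_Mapping.lookup y t = 0" "Poly_Mapping.lookup z t = 0" if "t \<notin> {1..T}" for t
      using Q that unfolding Q_ensemble_def vecs_def by (auto simp: in_keys_iff)
    have inside: "Poly_Mapping.lookup z t = cell_vector (tree t) (threshold_value K \<theta> x) \<and>
        Poly_Mapping.lookup y t = (\<Sum>l = 1..p t. score t l * Poly_Mapping.lookup (Poly_Mapping.lookup z t) l)"
      if "t \<in> {1..T}" for t
      using Q iff[OF that] that unfolding Q_ensemble_def by blast
    have "Poly_Mapping.lookup y t = Poly_Mapping.lookup (fst (snd (ensemble_point K \<theta> T tree p score x))) t" for t
      using inside[of t] outside(1)[of t] by (cases "t \<in> {1..T}") (simp_all add: ensemble_point_def)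
    moreover have "Poly_Mapping.lookup z t = Poly_Mapping.lookup (snd (snd (ensemble_point K \<theta> T tree p score x))) t" for t
      using inside[of t] outside(2)[of t] by (cases "t \<in> {1..T}") (simp_all add: ensemble_point_def)
    ultimately have "y = fst (snd (ensemble_point K \<theta> T tree p score x))"
        "z = snd (snd (ensemble_point K \<theta> T tree p score x))"
      by (auto intro: poly_mapping_eqI)
    then show "x \<in> monotone_box K \<and> (x, y, z) = ensemble_point K \<theta> T tree p score x"
      using box[OF Q] by (simp add: ensemble_point_def Let_def)
  next
    assume point: "x \<in> monotone_box K \<and> (x, y, z) = ensemble_point K \<theta> T tree p score x"
    then have lookup: "Poly_Mapping.lookup z =
        (\<lambda>t. cell_vector (tree t) (threshold_value K \<theta> x) when t \<in> {1..T})"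
      "Poly_Mapping.lookup y = (\<lambda>t. (\<Sum>l = 1..p t. score t l *
        cell_length (tree t) (threshold_value K \<theta> x) 0 1 l) when t \<in> {1..T})"
      by (simp_all add: ensemble_point_def Let_def)
    have "x \<in> vecs K" "y \<in> vecs T" "z \<in> vecs T"
      using point by (auto simp: monotone_box_def vecs_def in_keys_iff lookup when_def split: if_splits)
    moreover have "(x, Poly_Mapping.lookup y t, Poly_Mapping.lookup z t)
        \<in> Q_expset K \<theta> (tree t) (p t) (score t)" if "t \<in> {1..T}" for t
      unfolding iff[OF that] using point that by (simp add: lookup)
    ultimately show "(x, y, z) \<in> Q_ensemble K \<theta> T tree p score"
      by (simp add: Q_ensemble_def)
  qed
  then show ?thesis
    by (fastforce simp: image_iff ensemble_point_def Let_def)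
qed

text \<open>
  The minima and maxima in the cell lengths are not linear in \<open>x\<close>, so this is not true of every way
  of writing \<open>x\<close> as a mean.  Here both summands arise from \<open>x\<close> by monotone maps, so every minimum
  and maximum selects the same entry in all three points.
\<close>

lemma ensemble_point_average:
  assumes F: "mono F" "F 0 = 0" "F 1 = 1" and G: "mono G" "G 0 = 0" "G 1 = 1"
    and FG: "\<And>v. F v + G v = 2 * v"
  shows "ensemble_point K \<theta> T tree p score (Poly_Mapping.map F x) +
      ensemble_point K \<theta> T tree p score (Poly_Mapping.map G x) =
    2 *\<^sub>R ensemble_point K \<theta> T tree p score x"
proof -
  have value_map: "threshold_value K \<theta> (Poly_Mapping.map H x) = H \<circ> threshold_value K \<theta> x"
    if "H 0 = 0" for H
    using that by (simp add: threshold_value_def lookup_map_zero fun_eq_iff)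
  have cells: "cell_length t (F \<circ> g) 0 1 l + cell_length t (G \<circ> g) 0 1 l = 2 * cell_length t g 0 1 l"
    for t g l
    using cell_length_average[OF F(1) G(1) FG, of t g 0 1 l] F G by simp
  have "Poly_Mapping.map F x + Poly_Mapping.map G x = 2 *\<^sub>R x"
    by (rule poly_mapping_eqI) (simp add: lookup_add lookup_scaleR lookup_map_zero F G FG)
  moreover have "(\<Sum>l = 1..n. w l * cell_length t (F \<circ> g) 0 1 l) + (\<Sum>l = 1..n. w l * cell_length t (G \<circ> g) 0 1 l) =
      2 * (\<Sum>l = 1..n. w l * cell_length t g 0 1 l)" for n w t g
    by (simp add: sum_distrib_left cells algebra_simps flip: sum.distrib distrib_left)
  ultimately show ?thesis
    by (auto simp: ensemble_point_def Let_def value_map F G scaleR_prod_def lookup_add lookup_scaleR when_def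
      cells intro!: poly_mapping_eqI)
qed

theorem theorem4:
  fixes T K :: nat
    and tree :: "nat \<Rightarrow> dtree"
    and p :: "nat \<Rightarrow> nat"
    and score :: "nat \<Rightarrow> nat \<Rightarrow> real"
    and \<theta> :: "nat \<Rightarrow> real"
  assumes leaves: "\<And>t. t \<in> {1..T} \<Longrightarrow> leaves_numbered (tree t) (p t)"
    and thresholds: "\<theta> ` {1..K} = (\<Union>t \<in> {1..T}. threshold ` splits (tree t))"
    and increasing: "strict_mono_on {1..K} \<theta>"
  shows "ideal_formulation (Q_ensemble K \<theta> T tree p score)
           {(\<lambda>(x, y, z). Poly_Mapping.lookup x j) | j. j \<in> {1..K}}"
proof -
  let ?point = "ensemble_point K \<theta> T tree p score"
  define F G :: "real \<Rightarrow> real" where "F v = min 1 (2 * v)" and "G v = max 0 (2 * v - 1)" for v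
  have F: "mono F" "F 0 = 0" "F 1 = 1" and G: "mono G" "G 0 = 0" "G 1 = 1"
    and FG: "F v + G v = 2 * v" for v
    by (auto simp: F_def G_def mono_def)
  have Q: "Q_ensemble K \<theta> T tree p score = ?point ` monotone_box K"
    by (rule Q_ensemble_eq_image[OF leaves thresholds increasing])
  have binary: "Poly_Mapping.lookup x j \<in> {0, 1}"
    if extreme: "?point x extreme_point_of Q_ensemble K \<theta> T tree p score"
      and x: "x \<in> monotone_box K" and j: "j \<in> {1..K}" for x j
  proof (rule ccontr)
    assume fractional: "Poly_Mapping.lookup x j \<notin> {0, 1}"
    let ?u = "?point (Poly_Mapping.map F x)" and ?w = "?point (Poly_Mapping.map G x)"
    have "?u \<in> Q_ensemble K \<theta> T tree p score" "?w \<in> Q_ensemble K \<theta> T tree p score"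
      using monotone_box_map[OF x F] monotone_box_map[OF x G] by (auto simp: Q)
    moreover have "?point x \<in> open_segment ?u ?w"
    proof -
      have "0 \<le> Poly_Mapping.lookup x j" "Poly_Mapping.lookup x j \<le> 1"
        using x j by (auto simp: monotone_box_def)
      then have "F (Poly_Mapping.lookup x j) \<noteq> G (Poly_Mapping.lookup x j)"
        using fractional by (auto simp: F_def G_def min_def max_def)
      then have "Poly_Mapping.map F x \<noteq> Poly_Mapping.map G x"
        using lookup_map_zero[of F x j] lookup_map_zero[of G x j] F G by metis
      then have "?u \<noteq> ?w"
        by (simp add: ensemble_point_def Let_def)
      moreover have "midpoint ?u ?w = ?point x"
        by (simp add: midpoint_def ensemble_point_average[OF F G FG])
      ultimately show ?thesis
        using midpoint_in_open_segment by metis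
    qed
    ultimately show False
      using extreme by (auto simp: extreme_point_of_def)
  qed
  have "Poly_Mapping.lookup (fst v) j \<in> {0, 1}"
    if v: "v extreme_point_of Q_ensemble K \<theta> T tree p score" and j: "j \<in> {1..K}" for v j
  proof -
    obtain x where x: "x \<in> monotone_box K" "v = ?point x"
      using v by (auto simp: extreme_point_of_def Q)
    then show ?thesis
      using binary[of x j] v j by (simp add: ensemble_point_def Let_def)
  qed
  then show ?thesis
    by (fastforce simp: ideal_formulation_def case_prod_beta)
qed

end
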